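(* Let $A$ be a commutative ring with unit. The eñe product $\star$ is an internal operation of $\mathcal{A}=1+XA[[X]]$. If $A$ is a subring of $\mathbb{C}$, and $f,g\in\mathcal{A}$ are polynomials with roots $(\alpha_i)_i$ and $(\beta_j)_j$ in $\mathbb{C}$ respectively (counted with multiplicity), then $f\star g$ is a polynomial whose roots (counted with multiplicity) are $(\alpha_i\beta_j)_{i,j}$.
   Context: For $n\ge1$, let $Q_n\in\mathbb{Z}[X_1,\dots,X_n,Y_1,\dots,Y_n]$ be the unique polynomial such that in $\mathbb{Z}[x_1,\dots,x_n,y_1,\dots,y_n]$ the $n$-th elementary symmetric polynomial of the $n^2$ products $x_iy_j$ equals $Q_n(e_1(x),\dots,e_n(x),e_1(y),\dots,e_n(y))$, where $e_k$ are the elementary symmetric polynomials. For $f=1+\sum_{n\ge1}a_nX^n$ and $g=1+\sum_{n\ge1}b_nX^n$ in $\mathcal{A}$, the eñe product is $f\star g=1+\sum_{n\ge1}c_nX^n$ with $c_n=(-1)^nQ_n(a_1,\dots,a_n,b_1,\dots,b_n)$. *)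

theory Defs
  imports
    "HOL-Algebra.Algebraic_Closure_Type"
    "HOL-Algebra.Subrings"
    "HOL-Library.Poly_Mapping"
    "HOL-Computational_Algebra.Computational_Algebra"
    Complex_Main
begin

text \<open>
  Polynomials over the integers in two families of indeterminates, one indexed by
  \<open>Inl k\<close> and one by \<open>Inr k\<close>: finitely supported maps from monomials to coefficients, a
  monomial being a finitely supported map from indeterminates to exponents. The type serves both
  for \<open>\<int>[x\<^sub>1,\<dots>,x\<^sub>n,y\<^sub>1,\<dots>,y\<^sub>n]\<close> and for \<open>\<int>[X\<^sub>1,\<dots>,X\<^sub>n,Y\<^sub>1,\<dots>,Y\<^sub>n]\<close>; the bound \<open>n\<close> is imposed by
  \<open>indets\<close>.
\<close>

type_synonym zpoly = "((nat + nat) \<Rightarrow>\<^sub>0 nat) \<Rightarrow>\<^sub>0 int"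

definition indet :: "nat + nat \<Rightarrow> zpoly"
  where "indet v = Poly_Mapping.single (Poly_Mapping.single v 1) 1"

definition indets :: "zpoly \<Rightarrow> (nat + nat) set"
  where "indets P = (\<Union>m\<in>Poly_Mapping.keys P. Poly_Mapping.keys m)"

definition eval_zpoly :: "('a, 'm) ring_scheme \<Rightarrow> (nat + nat \<Rightarrow> 'a) \<Rightarrow> zpoly \<Rightarrow> 'a"
  where "eval_zpoly R \<sigma> P =
    (\<Oplus>\<^bsub>R\<^esub>m\<in>Poly_Mapping.keys P. [Poly_Mapping.lookup P m] \<cdot>\<^bsub>R\<^esub>
      (\<Otimes>\<^bsub>R\<^esub>v\<in>Poly_Mapping.keys m. \<sigma> v [^]\<^bsub>R\<^esub> Poly_Mapping.lookup m v))"

definition elem_sym :: "'i set \<Rightarrow> ('i \<Rightarrow> 'a::comm_ring_1) \<Rightarrow> nat \<Rightarrow> 'a"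
  where "elem_sym I u k = (\<Sum>S | S \<subseteq> I \<and> card S = k. \<Prod>i\<in>S. u i)"

text \<open>
  The polynomial \<open>Q\<^sub>n\<close>, for \<open>n \<ge> 1\<close>. It is evaluated here in the polynomial ring itself, at
  \<open>X\<^sub>k = e\<^sub>k(x\<^sub>1,\<dots>,x\<^sub>n)\<close> and \<open>Y\<^sub>k = e\<^sub>k(y\<^sub>1,\<dots>,y\<^sub>n)\<close>.
\<close>

definition ene_poly :: "nat \<Rightarrow> zpoly"
  where "ene_poly n = (THE Q.
    indets Q \<subseteq> Inl ` {1..n} \<union> Inr ` {1..n} \<and>
    eval_zpoly ring_of_type_algebra
      (case_sum (elem_sym {1..n} (\<lambda>i. indet (Inl i))) (elem_sym {1..n} (\<lambda>j. indet (Inr j)))) Q =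
    elem_sym ({1..n} \<times> {1..n}) (\<lambda>(i, j). indet (Inl i) * indet (Inr j)) n)"

text \<open>
  The set \<open>1 + X A[[X]]\<close> and its product, for a ring \<open>A\<close> with an explicit carrier. The type
  \<open>'a fps\<close> is used only as the type of coefficient sequences; all coefficient arithmetic
  is that of the ring \<open>A\<close>. The zero ring is allowed.
\<close>

definition one_series :: "('a, 'm) ring_scheme \<Rightarrow> 'a fps set"
  where "one_series A = {f. fps_nth f 0 = \<one>\<^bsub>A\<^esub> \<and> (\<forall>n. fps_nth f n \<in> carrier A)}"

definition ene_prod ::
    "('a, 'm) ring_scheme \<Rightarrow> 'a fps \<Rightarrow> 'a fps \<Rightarrow> 'a fps"  (infixl \<open>\<star>\<index>\<close> 70)
  where "f \<star>\<^bsub>A\<^esub> g = Abs_fps (\<lambda>n. if n = 0 then \<one>\<^bsub>A\<^esub> else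
    (\<ominus>\<^bsub>A\<^esub> \<one>\<^bsub>A\<^esub>) [^]\<^bsub>A\<^esub> n \<otimes>\<^bsub>A\<^esub> eval_zpoly A (case_sum (fps_nth f) (fps_nth g)) (ene_poly n))"

end

theory Submission
  imports Defs "HOL-Library.Countable" "Jordan_Normal_Form.Determinant"
begin

text \<open>
  \<^emph>\<open>Uniqueness of \<open>Q\<^sub>n\<close>.\<close> Over \<open>\<complex>\<close> every pair \<open>(a, b)\<close> of \<open>n\<close>-tuples is the pair of elementary symmetric
  functions of some \<open>u\<close>, \<open>v\<close>, so \<open>Q\<^sub>n\<close> is determined as a function on \<open>\<complex>\<^sup>2\<^sup>n\<close>, hence as a polynomial.

  \<^emph>\<open>Existence.\<close> \<open>\<Prod>\<^sub>i\<^sub>,\<^sub>j (1 + u\<^sub>i v\<^sub>j X) = \<Prod>\<^sub>i g(u\<^sub>i)\<close> with \<open>g(T) = \<Sum>\<^sub>l e\<^sub>l(v) X\<^sup>l T\<^sup>l\<close> is the determinant of multiplication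
  by \<open>g\<close> modulo \<open>\<Prod>\<^sub>i (T - u\<^sub>i)\<close>. In the basis of powers of \<open>T\<close> its entries are integer polynomials in
  \<open>e(u)\<close>, \<open>e(v)\<close>; for distinct \<open>u\<^sub>i\<close> it is diagonalized by the Vandermonde matrix. Agreement at enough
  points with distinct coordinates gives the polynomial identity.

  \<^emph>\<open>More than \<open>n\<close> roots.\<close> \<open>Q\<^sub>n\<close> only concerns \<open>n\<close> variables of each kind. To compute the \<open>n\<close>-th
  coefficient of \<open>p \<star> q\<close> for \<open>p\<close> of larger degree, replace the inverse roots of \<open>p\<close> by \<open>n\<close> numbers whose
  generating polynomial agrees with \<open>p\<close> modulo \<open>X\<^sup>n\<^sup>+\<^sup>1\<close>, and likewise for \<open>q\<close>. By Newton's identities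
  the power sums up to \<open>n\<close> do not change, neither do their products, which are the power sums of
  the \<open>u\<^sub>i v\<^sub>j\<close>, and so neither does the \<open>n\<close>-th coefficient of \<open>\<Prod>\<^sub>i\<^sub>,\<^sub>j (1 - u\<^sub>i v\<^sub>j X)\<close>.
\<close>

section \<open>Values of integer polynomials\<close>

definition meval :: "('v \<Rightarrow> 'a::comm_ring_1) \<Rightarrow> ('v \<Rightarrow>\<^sub>0 nat) \<Rightarrow> 'a"
  where "meval \<sigma> m = (\<Prod>v\<in>Poly_Mapping.keys m. \<sigma> v ^ Poly_Mapping.lookup m v)"

text \<open>The type-class counterpart of \<open>eval_zpoly\<close>, free of carrier conditions.
  With values in integer polynomials it is substitution.\<close>

definition zeval :: "('v \<Rightarrow> 'a::comm_ring_1) \<Rightarrow> (('v \<Rightarrow>\<^sub>0 nat) \<Rightarrow>\<^sub>0 int) \<Rightarrow> 'a"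
  where "zeval \<sigma> P = (\<Sum>m\<in>Poly_Mapping.keys P. of_int (Poly_Mapping.lookup P m) * meval \<sigma> m)"

lemma meval_superset:
  assumes "finite V" "Poly_Mapping.keys m \<subseteq> V"
  shows "meval \<sigma> m = (\<Prod>v\<in>V. \<sigma> v ^ Poly_Mapping.lookup m v)"
  unfolding meval_def using assms
  by (intro prod.mono_neutral_left) (auto simp: in_keys_iff)

lemma meval_0 [simp]: "meval \<sigma> 0 = 1"
  by (simp add: meval_def)

lemma meval_add: "meval \<sigma> (m + m') = meval \<sigma> m * meval \<sigma> m'"
proof -
  let ?V = "Poly_Mapping.keys m \<union> Poly_Mapping.keys m'"
  have "meval \<sigma> (m + m') = (\<Prod>v\<in>?V. \<sigma> v ^ Poly_Mapping.lookup (m + m') v)"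
    by (rule meval_superset) (auto intro!: Poly_Mapping.keys_add)
  also have "\<dots> = (\<Prod>v\<in>?V. \<sigma> v ^ Poly_Mapping.lookup m v) * (\<Prod>v\<in>?V. \<sigma> v ^ Poly_Mapping.lookup m' v)"
    by (simp add: lookup_add power_add prod.distrib)
  also have "\<dots> = meval \<sigma> m * meval \<sigma> m'"
    by (simp add: meval_superset[of ?V])
  finally show ?thesis .
qed

lemma zeval_superset:
  assumes "finite M" "Poly_Mapping.keys P \<subseteq> M"
  shows "zeval \<sigma> P = (\<Sum>m\<in>M. of_int (Poly_Mapping.lookup P m) * meval \<sigma> m)"
  unfolding zeval_def using assms
  by (intro sum.mono_neutral_left) (auto simp: in_keys_iff)

lemma zeval_0 [simp]: "zeval \<sigma> 0 = 0"
  by (simp add: zeval_def)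

lemma zeval_single: "zeval \<sigma> (Poly_Mapping.single m c) = of_int c * meval \<sigma> m"
  by (subst zeval_superset[of "{m}"]) auto

lemma zeval_1 [simp]: "zeval \<sigma> 1 = 1"
  using zeval_single[of \<sigma> 0 1] by simp

lemma zeval_indet: "zeval \<sigma> (indet v) = \<sigma> v"
  by (simp add: indet_def zeval_single meval_def)

lemma zeval_add: "zeval \<sigma> (P + Q) = zeval \<sigma> P + zeval \<sigma> Q"
proof -
  let ?M = "Poly_Mapping.keys P \<union> Poly_Mapping.keys Q"
  have "zeval \<sigma> (P + Q) = (\<Sum>m\<in>?M. of_int (Poly_Mapping.lookup (P + Q) m) * meval \<sigma> m)"
    by (rule zeval_superset) (auto intro!: Poly_Mapping.keys_add)
  also have "\<dots> = zeval \<sigma> P + zeval \<sigma> Q"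
    by (simp add: zeval_superset[of ?M] lookup_add algebra_simps sum.distrib)
  finally show ?thesis .
qed

lemma zeval_sum: "zeval \<sigma> (\<Sum>i\<in>I. f i) = (\<Sum>i\<in>I. zeval \<sigma> (f i))"
  by (induction I rule: infinite_finite_induct) (auto simp: zeval_add)

lemma zeval_uminus: "zeval \<sigma> (- P) = - zeval \<sigma> P"
  using zeval_add[of \<sigma> P "- P"] by (simp add: eq_neg_iff_add_eq_0 add.commute)

lemma zeval_diff: "zeval \<sigma> (P - Q) = zeval \<sigma> P - zeval \<sigma> Q"
  using zeval_add[of \<sigma> P "- Q"] by (simp add: zeval_uminus)

lemma poly_mapping_eq_sum_single:
  fixes P :: "'a \<Rightarrow>\<^sub>0 'b::comm_monoid_add"
  shows "P = (\<Sum>m\<in>Poly_Mapping.keys P. Poly_Mapping.single m (Poly_Mapping.lookup P m))"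
  by (rule poly_mapping_eqI)
     (auto simp: lookup_sum lookup_single when_def in_keys_iff)

lemma zeval_mult: "zeval \<sigma> (P * Q) = zeval \<sigma> P * zeval \<sigma> Q"
proof -
  have "P * Q = (\<Sum>m\<in>Poly_Mapping.keys P. \<Sum>m'\<in>Poly_Mapping.keys Q.
      Poly_Mapping.single (m + m') (Poly_Mapping.lookup P m * Poly_Mapping.lookup Q m'))"
    by (rule trans[OF arg_cong2[of _ _ _ _ "(*)",
          OF poly_mapping_eq_sum_single[of P] poly_mapping_eq_sum_single[of Q]]])
       (simp add: sum_product mult_single)
  then show ?thesis
    by (simp add: zeval_sum zeval_single meval_add zeval_def[of _ P] zeval_def[of _ Q]
        sum_product algebra_simps)
qed

lemma zeval_prod: "zeval \<sigma> (\<Prod>i\<in>I. f i) = (\<Prod>i\<in>I. zeval \<sigma> (f i))"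
  by (induction I rule: infinite_finite_induct) (auto simp: zeval_mult)

lemma zeval_power: "zeval \<sigma> (P ^ k) = zeval \<sigma> P ^ k"
  by (induction k) (auto simp: zeval_mult)

lemma zeval_of_nat: "zeval \<sigma> (of_nat k) = of_nat k"
  by (induction k) (auto simp: zeval_add)

lemma zeval_of_int: "zeval \<sigma> (of_int c) = of_int c"
  by (cases c rule: int_diff_cases) (simp add: zeval_diff zeval_of_nat)

lemma zeval_zeval: "zeval \<tau> (zeval \<sigma> P) = zeval (\<lambda>v. zeval \<tau> (\<sigma> v)) P"
  by (simp add: zeval_def[of \<sigma>] zeval_def[of "\<lambda>v. zeval \<tau> (\<sigma> v)"] meval_def[of \<sigma>]
      meval_def[of "\<lambda>v. zeval \<tau> (\<sigma> v)"] zeval_sum zeval_mult zeval_of_int zeval_prod zeval_power)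

lemma zeval_cong:
  assumes "\<And>v. v \<in> indets P \<Longrightarrow> \<sigma> v = \<tau> v"
  shows "zeval \<sigma> P = zeval \<tau> P"
  unfolding zeval_def meval_def
  by (intro sum.cong prod.cong arg_cong2[of _ _ _ _ "(*)"] arg_cong2[of _ _ _ _ "(^)"] refl assms)
     (auto simp: indets_def)

lemma zeval_elem_sym:
  "zeval \<sigma> (elem_sym I u k) = elem_sym I (\<lambda>i. zeval \<sigma> (u i)) k"
  by (simp add: elem_sym_def zeval_sum zeval_prod)

section \<open>Indeterminates occurring in a polynomial\<close>

lemma indets_0 [simp]: "indets 0 = {}" and indets_1 [simp]: "indets 1 = {}"
  by (auto simp: indets_def)

lemma indets_uminus [simp]: "indets (- P) = indets P"
  by (simp add: indets_def keys_def)

lemma indets_indet [simp]: "indets (indet v) = {v}"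
  by (simp add: indets_def indet_def)

lemma indets_add: "indets (P + Q) \<subseteq> indets P \<union> indets Q"
  unfolding indets_def using Poly_Mapping.keys_add[of P Q] by blast

lemma indets_mult: "indets (P * Q) \<subseteq> indets P \<union> indets Q"
proof
  fix v assume "v \<in> indets (P * Q)"
  then obtain m where "m \<in> Poly_Mapping.keys (P * Q)" and v: "v \<in> Poly_Mapping.keys m"
    by (auto simp: indets_def)
  then obtain a b where "a \<in> Poly_Mapping.keys P" "b \<in> Poly_Mapping.keys Q" "m = a + b"
    using keys_mult[of P Q] by blast
  then show "v \<in> indets P \<union> indets Q"
    using v Poly_Mapping.keys_add[of a b] by (auto simp: indets_def)
qed

text \<open>Distinct monomials take distinct values at distinct primes, by unique factorization, and a
  polynomial in one variable separates these values. Restricting to prime powers costs nothing here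
  and provides points with distinct nonzero coordinates, where the Vandermonde determinant is nonzero.\<close>

lemma zpoly_eq_0_if_vanishing_at_prime_powers:
  fixes P :: zpoly and \<pi> :: "nat + nat \<Rightarrow> nat"
  assumes "inj \<pi>" and "\<And>v. prime (\<pi> v)"
    and vanish: "\<And>k. k \<ge> 1 \<Longrightarrow> zeval (\<lambda>v. of_nat (\<pi> v) ^ k :: complex) P = 0"
  shows "P = 0"
proof (rule ccontr)
  assume "P \<noteq> 0"
  define M where "M m = (\<Prod>v\<in>Poly_Mapping.keys m. \<pi> v ^ Poly_Mapping.lookup m v)" for m
  have mult_M: "multiplicity (\<pi> v) (M m) = Poly_Mapping.lookup m v" for v m
  proof -
    have "M m = (\<Prod>p\<in>\<pi> ` Poly_Mapping.keys m. p ^ Poly_Mapping.lookup m (inv_into UNIV \<pi> p))"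
      unfolding M_def using assms(1) by (subst prod.reindex) (auto simp: inj_on_def inj_def)
    also have "multiplicity (\<pi> v) \<dots> = (if \<pi> v \<in> \<pi> ` Poly_Mapping.keys m
        then Poly_Mapping.lookup m (inv_into UNIV \<pi> (\<pi> v)) else 0)"
      using assms(2) by (intro multiplicity_prod_prime_powers) auto
    finally show ?thesis
      using assms(1) by (auto simp: inj_image_mem_iff in_keys_iff inv_f_f)
  qed
  then have inj_M: "M m = M m' \<longleftrightarrow> m = m'" for m m'
    by (metis poly_mapping_eqI)
  have M_pos: "M m > 0" for m
    unfolding M_def using assms(2) by (auto intro!: prod_pos simp: prime_gt_0_nat)
  have meval_eq: "meval (\<lambda>v. of_nat (\<pi> v) ^ k) m = (of_nat (M m) :: complex) ^ k" for m k
    by (simp add: meval_def M_def power_mult[symmetric] mult.commute prod_power_distrib)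
  \<comment> \<open>As \<open>f\<close> has no constant term, the sum is a linear combination of the
    values of \<open>P\<close> assumed to vanish, those with \<open>k \<ge> 1\<close>.\<close>
  have sum0: "(\<Sum>m\<in>Poly_Mapping.keys P. of_int (Poly_Mapping.lookup P m) * poly f (of_nat (M m))) = 0"
    if "poly f 0 = 0" for f :: "complex poly"
  proof -
    have "(\<Sum>m\<in>Poly_Mapping.keys P. of_int (Poly_Mapping.lookup P m) * poly f (of_nat (M m))) =
        (\<Sum>m\<in>Poly_Mapping.keys P. \<Sum>k\<le>degree f.
          coeff f k * (of_int (Poly_Mapping.lookup P m) * of_nat (M m) ^ k))"
      by (simp add: poly_altdef sum_distrib_left algebra_simps)
    also have "\<dots> = (\<Sum>k\<le>degree f. coeff f k * zeval (\<lambda>v. of_nat (\<pi> v) ^ k) P)"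
      by (subst sum.swap) (simp add: zeval_def meval_eq sum_distrib_left)
    also have "\<dots> = 0"
    proof (intro sum.neutral ballI)
      fix k show "coeff f k * zeval (\<lambda>v. of_nat (\<pi> v) ^ k) P = 0"
        using that vanish[of k] by (cases "k = 0") (auto simp: poly_0_coeff_0)
    qed
    finally show ?thesis .
  qed
  obtain m0 where m0: "m0 \<in> Poly_Mapping.keys P"
    using \<open>P \<noteq> 0\<close> by fastforce
  \<comment> \<open>\<open>f\<close> vanishes at 0 and at \<open>M m\<close> for every monomial
    \<open>m\<close> of \<open>P\<close> other than \<open>m0\<close>, which isolates the
    coefficient of \<open>m0\<close>.\<close>
  define f :: "complex poly" where
    "f = [:0, 1:] * (\<Prod>m\<in>Poly_Mapping.keys P - {m0}. [:- of_nat (M m), 1:])"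
  have "poly f 0 = 0" by (simp add: f_def)
  from sum0[OF this] have "of_int (Poly_Mapping.lookup P m0) * poly f (of_nat (M m0)) = 0"
  proof (subst (asm) sum.remove[OF _ m0])
    have "poly f (of_nat (M m)) = 0" if "m \<in> Poly_Mapping.keys P - {m0}" for m
      using that by (auto simp: f_def poly_prod)
    then show "of_int (Poly_Mapping.lookup P m0) * poly f (of_nat (M m0)) + 
      (\<Sum>m\<in>Poly_Mapping.keys P - {m0}. of_int (Poly_Mapping.lookup P m) * poly f (of_nat (M m))) = 0 \<Longrightarrow>
      of_int (Poly_Mapping.lookup P m0) * poly f (of_nat (M m0)) = 0"
      by simp
  qed auto
  moreover have "poly f (of_nat (M m0)) \<noteq> 0"
    using M_pos[of m0] inj_M by (auto simp: f_def poly_prod)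
  ultimately show False
    using m0 by (simp add: in_keys_iff)
qed

section \<open>Evaluation in rings with an explicit carrier\<close>

lemma eval_zpoly_closed:
  assumes "cring A" and "\<And>v. \<sigma> v \<in> carrier A"
  shows "eval_zpoly A \<sigma> P \<in> carrier A"
proof -
  interpret A: cring A by fact
  show ?thesis
    unfolding eval_zpoly_def using assms(2)
    by (auto intro!: A.finsum_closed A.add.int_pow_closed A.finprod_closed A.nat_pow_closed)
qed

text \<open>The operations of \<open>A\<close> are those of the type on a smaller carrier. Inverses,
  finite sums and finite products are only controlled on elements of \<open>S\<close>, hence the
  closure facts.\<close>

lemma eval_zpoly_subring:
  fixes S :: "'a::comm_ring_1 set"
  assumes S: "subring S ring_of_type_algebra" and A: "A = ring_of_type_algebra\<lparr>carrier := S\<rparr>"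
    and \<sigma>: "\<And>v. \<sigma> v \<in> S"
  shows "eval_zpoly A \<sigma> P = zeval \<sigma> P"
proof -
  interpret R: cring "ring_of_type_algebra :: 'a ring" by rule
  interpret A: cring A
    unfolding A using R.subcring_iff[of S] R.subcringI'[OF S] by (simp add: ring_of_type_algebra_def)
  have [simp]: "carrier A = S" "\<zero>\<^bsub>A\<^esub> = 0" "\<one>\<^bsub>A\<^esub> = 1" "\<And>x y. x \<oplus>\<^bsub>A\<^esub> y = x + y" "\<And>x y. x \<otimes>\<^bsub>A\<^esub> y = x * y"
    by (simp_all add: A ring_of_type_algebra_def)
  have neg: "\<ominus>\<^bsub>A\<^esub> x = - x" if "x \<in> S" for x
    using A.r_neg[of x] that by (simp add: eq_neg_iff_add_eq_0 add.commute)
  have pow: "x [^]\<^bsub>A\<^esub> n = x ^ n" for x and n :: nat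
    by (induction n) (simp_all add: mult.commute)
  have npow: "[n] \<cdot>\<^bsub>A\<^esub> x = of_nat n * x" for x and n :: nat
    by (induction n) (simp_all add: add_pow_def algebra_simps)
  have npow_closed: "of_nat n * x \<in> S" if "x \<in> S" for x and n :: nat
    using A.add.nat_pow_closed[of x n] that by (simp add: npow)
  have zpow: "[c] \<cdot>\<^bsub>A\<^esub> x = of_int c * x" if "x \<in> S" for x and c :: int
  proof (cases "c < 0")
    case True
    then have "[c] \<cdot>\<^bsub>A\<^esub> x = \<ominus>\<^bsub>A\<^esub> ([nat (- c)] \<cdot>\<^bsub>A\<^esub> x)"
      unfolding add_pow_def int_pow_def2 a_inv_def by (simp only: if_True)
    also have "\<dots> = - (of_nat (nat (- c)) * x)"
      by (simp only: npow neg[OF npow_closed[OF that]])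
    finally show ?thesis using True by simp
  next
    case False
    then have "[c] \<cdot>\<^bsub>A\<^esub> x = [nat c] \<cdot>\<^bsub>A\<^esub> x"
      unfolding add_pow_def int_pow_def2 by (simp only: if_False)
    then show ?thesis using False by (simp add: npow)
  qed
  have fprod: "finprod A f V = prod f V" if "finite V" "f \<in> V \<rightarrow> S" for f and V :: "'i set"
    using that by (induction V rule: finite_induct) (simp_all add: Pi_iff)
  have fsum: "finsum A f V = sum f V" if "finite V" "f \<in> V \<rightarrow> S" for f and V :: "'i set"
    using that by (induction V rule: finite_induct) (simp_all add: Pi_iff)
  have pow_closed: "x ^ n \<in> S" if "x \<in> S" for x and n :: nat
    using A.nat_pow_closed[of x n] that by (simp add: pow)
  have meval: "(\<Otimes>\<^bsub>A\<^esub>v\<in>Poly_Mapping.keys m. \<sigma> v [^]\<^bsub>A\<^esub> Poly_Mapping.lookup m v) = meval \<sigma> m" for m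
    unfolding meval_def by (subst fprod) (auto simp: pow pow_closed \<sigma>)
  have "meval \<sigma> m \<in> carrier A" for m
    unfolding meval[symmetric] using \<sigma> by (intro A.finprod_closed) (auto simp: pow pow_closed)
  then have meval_closed: "meval \<sigma> m \<in> S" for m
    by simp
  have "of_int c * meval \<sigma> m \<in> S" for c m
    using A.add.int_pow_closed[of "meval \<sigma> m" c] meval_closed by (simp add: zpow)
  then show ?thesis
    unfolding eval_zpoly_def zeval_def by (subst fsum) (auto simp: meval zpow meval_closed)
qed

lemma eval_zpoly_type_algebra: "eval_zpoly ring_of_type_algebra \<sigma> P = zeval \<sigma> P"
proof (rule eval_zpoly_subring)
  interpret R: cring "ring_of_type_algebra :: 'a ring" by rule
  show "subring UNIV (ring_of_type_algebra :: 'a ring)"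
    using R.carrier_is_subring by (simp add: ring_of_type_algebra_def)
qed (auto simp: ring_of_type_algebra_def)

lemma ene_prod_closed:
  assumes "cring A" "f \<in> one_series A" "g \<in> one_series A"
  shows "f \<star>\<^bsub>A\<^esub> g \<in> one_series A"
proof -
  interpret A: cring A by fact
  have "eval_zpoly A (case_sum (fps_nth f) (fps_nth g)) Q \<in> carrier A" for Q
    using assms by (intro eval_zpoly_closed) (auto simp: one_series_def split: sum.split)
  then show ?thesis
    by (auto simp: one_series_def ene_prod_def)
qed

section \<open>Elementary symmetric functions and power sums\<close>

text \<open>Expanding the product gives one term for each set \<open>S\<close> of factors from which
  the linear term is taken.\<close>

lemma coeff_prod_linear:
  fixes u :: "'i \<Rightarrow> 'a::comm_ring_1"
  assumes "finite I"
  shows "coeff (\<Prod>i\<in>I. [:1, u i:]) k = elem_sym I u k"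
proof -
  have "(\<Prod>i\<in>I. [:1, u i:]) = (\<Prod>i\<in>I. monom (u i) 1 + 1)"
    by (intro prod.cong refl) (simp add: monom_Suc monom_0 one_pCons)
  also have "\<dots> = (\<Sum>S\<in>Pow I. \<Prod>i\<in>S. monom (u i) 1)"
    using assms by (simp add: prod_add)
  also have "coeff \<dots> k = (\<Sum>S\<in>Pow I. if card S = k then \<Prod>i\<in>S. u i else 0)"
    unfolding coeff_sum
  proof (intro sum.cong refl)
    fix S assume "S \<in> Pow I"
    then have "finite S" using assms by (auto intro: finite_subset)
    then have "(\<Prod>i\<in>S. monom (u i) 1) = monom (\<Prod>i\<in>S. u i) (card S)"
      by (induction S rule: finite_induct) (auto simp: mult_monom)
    then show "coeff (\<Prod>i\<in>S. monom (u i) 1) k = (if card S = k then \<Prod>i\<in>S. u i else 0)"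
      by simp
  qed
  also have "\<dots> = elem_sym I u k"
    using assms by (simp add: elem_sym_def sum.If_cases Int_def)
  finally show ?thesis .
qed

lemma elem_sym_0 [simp]:
  assumes "finite I"
  shows "elem_sym I u 0 = 1"
proof -
  have "{S. S \<subseteq> I \<and> card S = 0} = {{}}"
    using assms by (auto dest: finite_subset)
  then show ?thesis by (simp add: elem_sym_def)
qed

lemma elem_sym_mult_left:
  "elem_sym I (\<lambda>i. c * u i) k = c ^ k * elem_sym I u k"
  unfolding elem_sym_def sum_distrib_left
  by (intro sum.cong refl) (auto simp: prod.distrib)

text \<open>Algebraic closedness: factor the monic polynomial with the prescribed coefficients and
  reverse it, which turns X + u_i into 1 + u_i X.\<close>

lemma elem_sym_surj:
  fixes a :: "nat \<Rightarrow> complex"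
  obtains u where "\<And>k. k \<in> {1..n} \<Longrightarrow> elem_sym {1..n} u k = a k"
proof -
  define b where "b k = (if k = 0 then 1 else a k)" for k
  define F where "F = (\<Sum>k\<le>n. monom (b k) (n - k))"
  have coeff_F: "coeff F (n - k) = b k" if "k \<le> n" for k
  proof -
    have "coeff F (n - k) = (\<Sum>j\<le>n. if j = k then b j else 0)"
      unfolding F_def coeff_sum using that by (intro sum.cong) auto
    then show ?thesis using that by simp
  qed
  have "degree F \<le> n"
    unfolding F_def by (intro degree_sum_le) (auto intro: order_trans[OF degree_monom_le])
  moreover have "coeff F n = 1" using coeff_F[of 0] by (simp add: b_def)
  ultimately have deg: "degree F = n"
    by (intro antisym le_degree) auto
  then have lead: "lead_coeff F = 1"
    using \<open>coeff F n = 1\<close> by simp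
  obtain r where r: "F = (\<Prod>i<n. [:- r i, 1:])"
    using complex_poly_decompose'[of F] lead deg by (metis smult_1_left)
  define u where "u i = - r (i - 1)" for i
  have F_eq: "F = (\<Prod>i\<in>{1..n}. [:u i, 1:])"
  proof -
    have "F = (\<Prod>i<n. [:- r i, 1:])" by (fact r)
    also have "\<dots> = (\<Prod>i\<in>{1..n}. [:u i, 1:])"
      by (rule prod.reindex_bij_witness[of _ "\<lambda>i. i - 1" Suc]) (auto simp: u_def)
    finally show ?thesis .
  qed
  have "reflect_poly [:u i, 1:] = [:1, u i:]" for i
    by (simp add: reflect_poly_def cCons_def)
  then have "reflect_poly F = (\<Prod>i\<in>{1..n}. [:1, u i:])"
    by (simp add: F_eq reflect_poly_prod)
  then have "elem_sym {1..n} u k = coeff (reflect_poly F) k" for k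
    by (simp add: coeff_prod_linear)
  then have "elem_sym {1..n} u k = b k" if "k \<le> n" for k
    using coeff_F[OF that] that by (simp add: coeff_reflect_poly deg)
  then have "elem_sym {1..n} u k = a k" if "k \<in> {1..n}" for k
    using that by (simp add: b_def)
  then show thesis using that by blast
qed

section \<open>Newton's identities\<close>

text \<open>Logarithmic derivative: F' = -P F, where P is the sum of the series u_i/(1 - u_i X) and
  has the power sums as coefficients. Compare coefficients of X^k.\<close>

lemma newton_identity:
  fixes u :: "'i \<Rightarrow> 'a::field_char_0"
  assumes "finite I"
  defines "F \<equiv> \<Prod>i\<in>I. [:1, - u i:]"
  shows "of_nat (Suc k) * coeff F (Suc k) = - (\<Sum>j\<le>k. (\<Sum>i\<in>I. u i ^ Suc j) * coeff F (k - j))"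
proof -
  define P where "P J = Abs_fps (\<lambda>k. \<Sum>i\<in>J. u i ^ Suc k)" for J
  have geom: "(1 - fps_const (u i) * fps_X) * Abs_fps (\<lambda>k. u i ^ Suc k) = fps_const (u i)" for i
    by (rule fps_ext) (auto simp: left_diff_distrib mult.assoc fps_X_mult_nth algebra_simps simp flip: power_Suc)
  have lin: "fps_of_poly [:1, - u i:] = 1 - fps_const (u i) * fps_X" for i
    by (simp add: fps_of_poly_pCons fps_const_neg mult.commute)
  have "fps_deriv (fps_of_poly (\<Prod>i\<in>J. [:1, - u i:])) = - (P J * fps_of_poly (\<Prod>i\<in>J. [:1, - u i:]))"
    if "finite J" for J
    using that
  proof (induction J rule: finite_induct)
    case empty
    then show ?case by (simp add: P_def fps_eq_iff)
  next
    case (insert i J)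
    define G where "G = fps_of_poly (\<Prod>i\<in>J. [:1, - u i:])"
    define L where "L = 1 - fps_const (u i) * fps_X"
    define Q where "Q = Abs_fps (\<lambda>k. u i ^ Suc k)"
    have PI: "P (insert i J) = P J + Q"
      using insert by (intro fps_ext) (simp add: P_def Q_def)
    have "fps_deriv L = - fps_const (u i)"
      by (simp add: L_def)
    moreover have "L * Q = fps_const (u i)"
      unfolding L_def Q_def by (rule geom)
    \<comment> \<open>The product rule, with L' = -u_i = -L Q.\<close>
    ultimately have "fps_deriv (L * G) = - (P (insert i J) * (L * G))"
      using insert.IH unfolding PI G_def[symmetric] by (simp add: algebra_simps del: fps_const_neg)
    moreover have "fps_of_poly (\<Prod>j\<in>insert i J. [:1, - u j:]) = L * G"
      by (simp only: prod.insert[OF insert.hyps] fps_of_poly_mult lin L_def G_def)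
    ultimately show ?case by simp
  qed
  from this[OF assms(1)] have "fps_nth (fps_deriv (fps_of_poly F)) k = - fps_nth (P I * fps_of_poly F) k"
    by (simp add: F_def)
  then show ?thesis
    by (simp add: fps_mult_nth P_def atLeast0AtMost)
qed

text \<open>Newton's identities give each coefficient from power sums and lower coefficients;
  dividing by \<open>Suc l\<close> uses characteristic 0.\<close>

lemma power_sums_determine_coeffs:
  fixes u :: "'i \<Rightarrow> 'a::field_char_0" and u' :: "'j \<Rightarrow> 'a"
  assumes "finite I" "finite J"
    and "\<And>k. k \<in> {1..n} \<Longrightarrow> (\<Sum>i\<in>I. u i ^ k) = (\<Sum>j\<in>J. u' j ^ k)"
    and "k \<le> n"
  shows "coeff (\<Prod>i\<in>I. [:1, - u i:]) k = coeff (\<Prod>j\<in>J. [:1, - u' j:]) k"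
  using \<open>k \<le> n\<close>
proof (induction k rule: less_induct)
  case (less k)
  show ?case
  proof (cases k)
    case 0
    then show ?thesis by (simp add: coeff_prod_linear assms)
  next
    case (Suc l)
    have "(of_nat (Suc l) :: 'a) * coeff (\<Prod>i\<in>I. [:1, - u i:]) (Suc l) =
        of_nat (Suc l) * coeff (\<Prod>j\<in>J. [:1, - u' j:]) (Suc l)"
      unfolding newton_identity[OF \<open>finite I\<close>] newton_identity[OF \<open>finite J\<close>]
      using less Suc assms(3) by (intro arg_cong[of _ _ uminus] sum.cong arg_cong2[of _ _ _ _ "(*)"]) (auto simp del: power_Suc)
    then show ?thesis
      unfolding Suc by (simp del: of_nat_Suc)
  qed
qed

text \<open>Newton's identities read the other way: the constant coefficient is 1, so they can be
  solved for the highest power sum.\<close>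

lemma coeffs_determine_power_sums:
  fixes u :: "'i \<Rightarrow> 'a::field_char_0" and u' :: "'j \<Rightarrow> 'a"
  assumes "finite I" "finite J"
    and coeffs: "\<And>k. k \<le> n \<Longrightarrow> coeff (\<Prod>i\<in>I. [:1, - u i:]) k = coeff (\<Prod>j\<in>J. [:1, - u' j:]) k"
    and "k \<in> {1..n}"
  shows "(\<Sum>i\<in>I. u i ^ k) = (\<Sum>j\<in>J. u' j ^ k)"
  using \<open>k \<in> {1..n}\<close>
proof (induction k rule: less_induct)
  case (less k)
  then obtain l where k: "k = Suc l" by (cases k) auto
  let ?F = "\<Prod>i\<in>I. [:1, - u i:]" and ?G = "\<Prod>j\<in>J. [:1, - u' j:]"
  have split: "(\<Sum>j\<le>l. f j) = (\<Sum>j<l. f j) + f l" for f :: "nat \<Rightarrow> 'a"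
    by (simp flip: lessThan_Suc_atMost)
  have "coeff ?F 0 = 1" "coeff ?G 0 = 1"
    using assms(1,2) by (simp_all add: coeff_prod_linear)
  moreover have "(\<Sum>j<l. (\<Sum>i\<in>I. u i ^ Suc j) * coeff ?F (l - j)) =
      (\<Sum>j<l. (\<Sum>i\<in>J. u' i ^ Suc j) * coeff ?G (l - j))"
    using less k coeffs by (intro sum.cong arg_cong2[of _ _ _ _ "(*)"]) (auto simp del: power_Suc)
  moreover have "coeff ?F (Suc l) = coeff ?G (Suc l)"
    using less k coeffs by simp
  ultimately show ?case
    using newton_identity[OF \<open>finite I\<close>, of l u] newton_identity[OF \<open>finite J\<close>, of l u']
    unfolding k split by simp
qed

text \<open>The power sums of the products \<open>u\<^sub>i v\<^sub>j\<close> are the products of the power sums.\<close>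

lemma coeff_prod_products_cong:
  fixes u u' v v' :: "_ \<Rightarrow> 'a::field_char_0"
  assumes fin: "finite I" "finite I'" "finite J" "finite J'"
    and "\<And>k. k \<le> n \<Longrightarrow> coeff (\<Prod>i\<in>I. [:1, - u i:]) k = coeff (\<Prod>i\<in>I'. [:1, - u' i:]) k"
    and "\<And>k. k \<le> n \<Longrightarrow> coeff (\<Prod>j\<in>J. [:1, - v j:]) k = coeff (\<Prod>j\<in>J'. [:1, - v' j:]) k"
  shows "coeff (\<Prod>(i, j)\<in>I \<times> J. [:1, - (u i * v j):]) n =
         coeff (\<Prod>(i, j)\<in>I' \<times> J'. [:1, - (u' i * v' j):]) n"
proof -
  have *: "(\<Prod>(i, j)\<in>A. [:1, - (f i * g j):]) = (\<Prod>p\<in>A. [:1, - (case p of (i, j) \<Rightarrow> f i * g j):])"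
    for A :: "('x \<times> 'y) set" and f and g :: "'y \<Rightarrow> 'a"
    by (intro prod.cong) auto
  have "(\<Sum>p\<in>I \<times> J. (case p of (i, j) \<Rightarrow> u i * v j) ^ k) =
      (\<Sum>p\<in>I' \<times> J'. (case p of (i, j) \<Rightarrow> u' i * v' j) ^ k)" if "k \<in> {1..n}" for k
  proof -
    have **: "(\<Sum>p\<in>A \<times> B. (case p of (i, j) \<Rightarrow> f i * g j) ^ k) = (\<Sum>i\<in>A. f i ^ k) * (\<Sum>j\<in>B. g j ^ k)"
      for A :: "'x set" and B :: "'y set" and f and g :: "'y \<Rightarrow> 'a"
      by (simp add: sum_product sum.cartesian_product power_mult_distrib case_prod_unfold)
    show ?thesis
      unfolding ** using coeffs_determine_power_sums[OF fin(1,2) assms(5) that]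
        coeffs_determine_power_sums[OF fin(3,4) assms(6) that] by simp
  qed
  then show ?thesis
    unfolding * using fin by (intro power_sums_determine_coeffs[of _ _ n]) auto
qed

section \<open>The resultant as an integer polynomial\<close>

text \<open>The closure properties of this predicate yield an integer polynomial for the determinant
  below without writing it down.\<close>

definition polyfun :: "(nat + nat) set \<Rightarrow> ((nat + nat \<Rightarrow> complex) \<Rightarrow> complex) \<Rightarrow> bool"
  where "polyfun V F \<longleftrightarrow> (\<exists>Q. indets Q \<subseteq> V \<and> (\<forall>\<sigma>. zeval \<sigma> Q = F \<sigma>))"

lemma polyfun_0: "polyfun V (\<lambda>\<sigma>. 0)"
  unfolding polyfun_def by (rule exI[of _ 0]) simp

lemma polyfun_1: "polyfun V (\<lambda>\<sigma>. 1)"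
  unfolding polyfun_def by (rule exI[of _ 1]) simp

lemma polyfun_indet: "v \<in> V \<Longrightarrow> polyfun V (\<lambda>\<sigma>. \<sigma> v)"
  unfolding polyfun_def by (rule exI[of _ "indet v"]) (simp add: zeval_indet)

lemma polyfun_add: "polyfun V F \<Longrightarrow> polyfun V G \<Longrightarrow> polyfun V (\<lambda>\<sigma>. F \<sigma> + G \<sigma>)"
  unfolding polyfun_def using indets_add by (metis (no_types, lifting) Un_least order_trans zeval_add)

lemma polyfun_mult: "polyfun V F \<Longrightarrow> polyfun V G \<Longrightarrow> polyfun V (\<lambda>\<sigma>. F \<sigma> * G \<sigma>)"
  unfolding polyfun_def using indets_mult by (metis (no_types, lifting) Un_least order_trans zeval_mult)

lemma polyfun_uminus: "polyfun V F \<Longrightarrow> polyfun V (\<lambda>\<sigma>. - F \<sigma>)"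
  unfolding polyfun_def by (metis indets_uminus zeval_uminus)

lemma polyfun_sum: "(\<And>i. i \<in> I \<Longrightarrow> polyfun V (F i)) \<Longrightarrow> polyfun V (\<lambda>\<sigma>. \<Sum>i\<in>I. F i \<sigma>)"
  by (induction I rule: infinite_finite_induct) (auto intro: polyfun_0 polyfun_add)

lemma polyfun_sign: "polyfun V (\<lambda>\<sigma>. (- 1) ^ k)"
  by (induction k) (auto intro: polyfun_1 polyfun_uminus)

definition ppolyfun :: "(nat + nat) set \<Rightarrow> ((nat + nat \<Rightarrow> complex) \<Rightarrow> complex poly) \<Rightarrow> bool"
  where "ppolyfun V F \<longleftrightarrow> (\<forall>k. polyfun V (\<lambda>\<sigma>. coeff (F \<sigma>) k))"

lemma ppolyfun_monom: "polyfun V f \<Longrightarrow> ppolyfun V (\<lambda>\<sigma>. monom (f \<sigma>) l)"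
  unfolding ppolyfun_def coeff_monom
proof
  fix k assume "polyfun V f"
  then show "polyfun V (\<lambda>\<sigma>. if l = k then f \<sigma> else 0)"
    by (cases "l = k") (simp_all add: polyfun_0)
qed

lemma ppolyfun_1: "ppolyfun V (\<lambda>\<sigma>. 1)"
  using ppolyfun_monom[OF polyfun_1, of V 0] by simp

lemma ppolyfun_uminus: "ppolyfun V F \<Longrightarrow> ppolyfun V (\<lambda>\<sigma>. - F \<sigma>)"
  by (simp add: ppolyfun_def polyfun_uminus)

lemma ppolyfun_mult: "ppolyfun V F \<Longrightarrow> ppolyfun V G \<Longrightarrow> ppolyfun V (\<lambda>\<sigma>. F \<sigma> * G \<sigma>)"
  unfolding ppolyfun_def coeff_mult by (auto intro!: polyfun_sum polyfun_mult)

lemma ppolyfun_sum: "(\<And>i. i \<in> I \<Longrightarrow> ppolyfun V (F i)) \<Longrightarrow> ppolyfun V (\<lambda>\<sigma>. \<Sum>i\<in>I. F i \<sigma>)"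
  by (auto simp: ppolyfun_def coeff_sum intro!: polyfun_sum)

lemma ppolyfun_prod: "(\<And>i. i \<in> I \<Longrightarrow> ppolyfun V (F i)) \<Longrightarrow> ppolyfun V (\<lambda>\<sigma>. \<Prod>i\<in>I. F i \<sigma>)"
  by (induction I rule: infinite_finite_induct) (auto intro: ppolyfun_1 ppolyfun_mult)

text \<open>By the Leibniz formula the determinant is built from the entries by sums, products and
  signs.\<close>

lemma ppolyfun_det:
  assumes "\<And>i j. i < n \<Longrightarrow> j < n \<Longrightarrow> ppolyfun V (\<lambda>\<sigma>. M \<sigma> i j)"
  shows "ppolyfun V (\<lambda>\<sigma>. det (mat n n (\<lambda>(i, j). M \<sigma> i j)))"
proof -
  have "det (mat n n (\<lambda>(i, j). M \<sigma> i j)) =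
      (\<Sum>p | p permutes {0..<n}. signof p * (\<Prod>i = 0..<n. M \<sigma> i (p i)))" for \<sigma>
    by (subst det_def'[of _ n]) (auto intro!: sum.cong arg_cong2[of _ _ _ _ "(*)"] prod.cong dest: permutes_in_image)
  moreover have "ppolyfun V (\<lambda>\<sigma>. signof p)" for p :: "nat \<Rightarrow> nat"
    by (cases "sign p = 1") (auto simp: sign_def intro: ppolyfun_1 ppolyfun_uminus)
  ultimately show ?thesis
    by (auto intro!: ppolyfun_sum ppolyfun_mult ppolyfun_prod assms dest: permutes_in_image)
qed

section \<open>Remainders of powers and the Vandermonde matrix\<close>

text \<open>The coefficient of \<open>T\<^sup>k\<close> in the remainder of \<open>T\<^sup>j\<close> modulo the monic polynomial
  \<open>T\<^sup>n - a\<^sub>1 T\<^sup>n\<^sup>-\<^sup>1 + a\<^sub>2 T\<^sup>n\<^sup>-\<^sup>2 - \<dots>\<close> whose roots have elementary symmetric functions \<open>a\<^sub>1, \<dots>, a\<^sub>n\<close>.\<close>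

primrec power_rem :: "nat \<Rightarrow> (nat \<Rightarrow> 'a::comm_ring_1) \<Rightarrow> nat \<Rightarrow> nat \<Rightarrow> 'a" where
  "power_rem n a 0 k = (if k = 0 then 1 else 0)"
| "power_rem n a (Suc j) k =
    (if k = 0 then 0 else power_rem n a j (k - 1)) - power_rem n a j (n - 1) * ((-1) ^ (n - k) * a (n - k))"

lemma polyfun_power_rem:
  assumes "Inl ` {1..n} \<subseteq> V" "k < n"
  shows "polyfun V (\<lambda>\<sigma>. power_rem n (\<lambda>i. \<sigma> (Inl i)) j k)"
  using assms(2)
proof (induction j arbitrary: k)
  case 0
  then show ?case by (auto intro: polyfun_0 polyfun_1)
next
  case (Suc j)
  have "Inl (n - k) \<in> V"
    using Suc.prems assms(1) by auto
  moreover have "polyfun V (\<lambda>\<sigma>. if k = 0 then 0 else power_rem n (\<lambda>i. \<sigma> (Inl i)) j (k - 1))"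
    using Suc by (cases "k = 0") (auto intro: polyfun_0)
  ultimately show ?case
    unfolding power_rem.simps diff_conv_add_uminus[of "if _ then _ else _"]
    using Suc by (intro polyfun_add polyfun_uminus polyfun_mult polyfun_sign polyfun_indet) auto
qed

text \<open>At a root z the remainder of T^j takes the value z^j. Multiplication by T shifts the
  coefficients, and the overflow at z^n is rewritten with the root equation.\<close>

lemma power_eq_sum_power_rem:
  assumes "n \<ge> 1" and root: "(\<Sum>l\<le>n. (-1) ^ (n - l) * a (n - l) * z ^ l) = 0" and "a 0 = 1"
  shows "(\<Sum>k<n. power_rem n a j k * z ^ k) = z ^ j"
proof (induction j)
  case 0
  have "(\<Sum>k<n. power_rem n a 0 k * z ^ k) = (\<Sum>k<n. if k = 0 then 1 else 0)"
    by (intro sum.cong) auto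
  then show ?case using assms(1) by simp
next
  case (Suc j)
  obtain m where n: "n = Suc m" using assms(1) by (cases n) auto
  let ?r = "power_rem n a j"
  have top: "z ^ n = - (\<Sum>k<n. (-1) ^ (n - k) * a (n - k) * z ^ k)"
    using root \<open>a 0 = 1\<close> by (simp add: lessThan_Suc_atMost[symmetric] add_eq_0_iff)
  have "(\<Sum>k<n. power_rem n a (Suc j) k * z ^ k) =
      (\<Sum>k<n. (if k = 0 then 0 else ?r (k - 1)) * z ^ k) -
      ?r (n - 1) * (\<Sum>k<n. (-1) ^ (n - k) * a (n - k) * z ^ k)"
    by (simp add: left_diff_distrib sum_subtractf sum_distrib_left mult.assoc)
  also have "\<dots> = (\<Sum>k<m. ?r k * z ^ Suc k) + ?r m * z ^ n"
    unfolding top by (simp add: n sum.lessThan_Suc_shift right_diff_distrib del: sum.lessThan_Suc)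
  also have "\<dots> = z * (\<Sum>k<n. ?r k * z ^ k)"
    by (simp add: n sum_distrib_left algebra_simps)
  finally show ?case using Suc by simp
qed

text \<open>The product of the T - u_j vanishes at T = u_i. Its expansion there comes from that of
  the product of the 1 + u_j X at X = -1/u_i, multiplied by u_i^n.\<close>

lemma elem_sym_root:
  fixes u :: "nat \<Rightarrow> 'a::field"
  assumes "i \<in> {1..n}" "u i \<noteq> 0"
  shows "(\<Sum>l\<le>n. (-1) ^ (n - l) * elem_sym {1..n} u (n - l) * u i ^ l) = 0"
proof -
  let ?F = "\<Prod>j\<in>{1..n}. [:1, u j:]"
  have "degree ?F \<le> (\<Sum>j\<in>{1..n}. degree [:1, u j:])"
    using degree_prod_sum_le[of "{1..n}" "\<lambda>j. [:1, u j:]"] by (simp add: o_def)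
  also have "\<dots> \<le> (\<Sum>j\<in>{1..n}. 1)"
    by (intro sum_mono) (simp add: degree_pCons_eq_if)
  \<comment> \<open>The degree bound lets the sum run up to \<open>n\<close> even if some u_j is
    0.\<close>
  finally have "poly ?F (- inverse (u i)) = (\<Sum>l\<le>n. coeff ?F l * (- inverse (u i)) ^ l)"
    unfolding poly_altdef by (intro sum.mono_neutral_left) (auto simp: coeff_eq_0)
  moreover have "poly ?F (- inverse (u i)) = 0"
    using assms by (auto simp: poly_prod intro!: prod_zero bexI[of _ i])
  ultimately have "0 = u i ^ n * (\<Sum>l\<le>n. elem_sym {1..n} u l * (- inverse (u i)) ^ l)"
    by (simp add: coeff_prod_linear)
  also have "\<dots> = (\<Sum>l\<le>n. (-1) ^ l * elem_sym {1..n} u l * u i ^ (n - l))"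
    unfolding sum_distrib_left
  proof (intro sum.cong refl)
    fix l assume "l \<in> {..n}"
    then have "u i ^ n * inverse (u i) ^ l = u i ^ (n - l)"
      using assms(2) by (simp add: power_diff field_simps)
    then have "(- 1) ^ l * elem_sym {1..n} u l * u i ^ (n - l) =
        (- 1) ^ l * elem_sym {1..n} u l * (u i ^ n * inverse (u i) ^ l)"
      by simp
    also have "\<dots> = u i ^ n * (elem_sym {1..n} u l * (- inverse (u i)) ^ l)"
      unfolding power_minus[of "inverse (u i)"] by (simp only: mult_ac)
    finally show "u i ^ n * (elem_sym {1..n} u l * (- inverse (u i)) ^ l) =
        (- 1) ^ l * elem_sym {1..n} u l * u i ^ (n - l)"
      by (rule sym)
  qed
  also have "\<dots> = (\<Sum>l\<le>n. (-1) ^ (n - l) * elem_sym {1..n} u (n - l) * u i ^ l)"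
    by (rule sum.reindex_bij_witness[of _ "\<lambda>l. n - l" "\<lambda>l. n - l"]) auto
  finally show ?thesis by simp
qed

text \<open>A kernel vector would be the coefficient vector of a nonzero polynomial of degree below
  \<open>n\<close> with \<open>n\<close> distinct roots.\<close>

lemma det_vandermonde_nonzero:
  fixes z :: "nat \<Rightarrow> 'a::idom"
  assumes "inj_on z {..<n}"
  shows "det (mat n n (\<lambda>(j, k). z j ^ k)) \<noteq> 0"
proof
  assume "det (mat n n (\<lambda>(j, k). z j ^ k)) = 0"
  then obtain c where c: "c \<in> carrier_vec n" "c \<noteq> 0\<^sub>v n" "mat n n (\<lambda>(j, k). z j ^ k) *\<^sub>v c = 0\<^sub>v n"
    by (auto simp: det_0_iff_vec_prod_zero[of _ n])
  define f where "f = (\<Sum>k<n. monom (c $ k) k)"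
  have coeff_f: "coeff f k = c $ k" if "k < n" for k
    using that by (simp add: f_def coeff_sum)
  obtain k where "k < n" "c $ k \<noteq> 0"
    using c(1,2) by (metis carrier_vecD eq_vecI index_zero_vec)
  then have "f \<noteq> 0" and "n > 0" using coeff_f by auto
  have "degree f < n"
    unfolding f_def using \<open>n > 0\<close> by (intro degree_sum_less) (auto intro: le_less_trans[OF degree_monom_le])
  have "poly f (z j) = 0" if "j < n" for j
  proof -
    have "(mat n n (\<lambda>(j, k). z j ^ k) *\<^sub>v c) $ j = poly f (z j)"
      using that c(1) by (simp add: f_def poly_sum poly_monom scalar_prod_def atLeast0LessThan mult.commute)
    then show ?thesis using c(3) that by simp
  qed
  then have "n \<le> card {x. poly f x = 0}"
    using card_mono[of "{x. poly f x = 0}" "z ` {..<n}"] poly_roots_finite[OF \<open>f \<noteq> 0\<close>] assms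
    by (auto simp: card_image)
  also have "\<dots> \<le> degree f"
    by (rule card_poly_roots_bound) fact
  finally show False using \<open>degree f < n\<close> by simp
qed

text \<open>With respect to the powers of \<open>T\<close>, multiplication by \<open>g = \<Sum>\<^sub>l b\<^sub>l (X T)\<^sup>l\<close> modulo
  \<open>f = \<Prod>\<^sub>i (T - u\<^sub>i)\<close>, where \<open>a\<^sub>k = e\<^sub>k(u)\<close> and \<open>b\<^sub>0\<close> is read as \<open>1\<close>; \<open>X\<close> is the variable of the entries. The
  determinant of this matrix is the resultant of \<open>f\<close> and \<open>g\<close>.\<close>

definition norm_entry :: "nat \<Rightarrow> (nat \<Rightarrow> 'a::comm_ring_1) \<Rightarrow> (nat \<Rightarrow> 'a) \<Rightarrow> nat \<Rightarrow> nat \<Rightarrow> 'a poly"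
  where "norm_entry n a b i k = (\<Sum>l\<le>n. monom ((if l = 0 then 1 else b l) * power_rem n a (i + l) k) l)"

text \<open>With \<open>c\<close> = u_i this is the value of g at T = u_i; the sum stops at
  \<open>n\<close> because \<open>{1..n}\<close> has no larger subsets.\<close>

lemma prod_eq_sum_elem_sym:
  fixes v :: "nat \<Rightarrow> 'a::comm_ring_1"
  shows "(\<Prod>w\<in>{1..n}. [:1, c * v w:]) = (\<Sum>l\<le>n. monom (c ^ l * elem_sym {1..n} v l) l)"
proof (rule poly_eqI)
  fix k
  have "elem_sym {1..n} v k = 0" if "k > n"
  proof -
    have "card S \<le> n" if "S \<subseteq> {1..n}" for S
      using card_mono[OF _ that] by simp
    then have "{S. S \<subseteq> {1..n} \<and> card S = k} = {}"
      using that by (auto simp del: One_nat_def simp: not_le[symmetric])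
    then show ?thesis by (simp only: elem_sym_def sum.empty)
  qed
  then have "(\<Sum>l\<le>n. if l = k then c ^ l * elem_sym {1..n} v l else 0) = c ^ k * elem_sym {1..n} v k"
    by (cases "k \<le> n") (simp_all del: One_nat_def)
  then show "coeff (\<Prod>w\<in>{1..n}. [:1, c * v w:]) k =
      coeff (\<Sum>l\<le>n. monom (c ^ l * elem_sym {1..n} v l) l) k"
    by (simp only: coeff_prod_linear finite_atLeastAtMost elem_sym_mult_left coeff_sum coeff_monom)
qed

text \<open>Row i of the matrix holds the remainder of T^i g, whose value at the root u_j is u_j^i
  g(u_j). So the Vandermonde matrix intertwines it with the diagonal matrix of the g(u_j), and the
  nonzero Vandermonde determinant cancels.\<close>

lemma det_norm_entry:
  fixes u v :: "nat \<Rightarrow> 'a::field"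
  assumes "n \<ge> 1" "inj_on u {1..n}" and nz: "\<And>i. i \<in> {1..n} \<Longrightarrow> u i \<noteq> 0"
  shows "det (mat n n (\<lambda>(i, k). norm_entry n (elem_sym {1..n} u) (elem_sym {1..n} v) i k)) =
    (\<Prod>(i, j)\<in>{1..n} \<times> {1..n}. [:1, u i * v j:])"
proof -
  \<comment> \<open>A constant polynomial, since the entries are polynomials in X;
    \<open>Suc\<close> because matrix indices start at 0.\<close>
  define z where "z j = [:u (Suc j):]" for j
  define D where "D j = (\<Prod>w\<in>{1..n}. [:1, u (Suc j) * v w:])" for j
  let ?e = "norm_entry n (elem_sym {1..n} u) (elem_sym {1..n} v)"
  define M where "M = mat n n (\<lambda>(i, k). ?e i k)"
  define W where "W = mat n n (\<lambda>(j, k). z j ^ k)"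
  define E where "E = mat n n (\<lambda>(i, j). if i = j then D j else 0)"
  have carr: "M \<in> carrier_mat n n" "W \<in> carrier_mat n n" "E \<in> carrier_mat n n"
    by (simp_all add: M_def W_def E_def)
  have "(\<Sum>k<n. ?e i k * z j ^ k) = z j ^ i * D j" if "j < n" for i j
  proof -
    have pr: "(\<Sum>k<n. power_rem n (elem_sym {1..n} u) m k * u (Suc j) ^ k) = u (Suc j) ^ m" for m
      using that assms(1) nz elem_sym_root[of "Suc j" n u] by (intro power_eq_sum_power_rem) auto
    have zpow: "z j ^ k = monom (u (Suc j) ^ k) 0" for k
      by (simp add: z_def monom_0 poly_const_pow)
    have "(\<Sum>k<n. ?e i k * z j ^ k) = (\<Sum>k<n. \<Sum>l\<le>n.
        monom ((if l = 0 then 1 else elem_sym {1..n} v l) *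
          (power_rem n (elem_sym {1..n} u) (i + l) k * u (Suc j) ^ k)) l)"
      by (simp add: norm_entry_def zpow sum_distrib_right mult_monom mult.assoc del: One_nat_def)
    also have "\<dots> = (\<Sum>l\<le>n. monom ((if l = 0 then 1 else elem_sym {1..n} v l) *
          (\<Sum>k<n. power_rem n (elem_sym {1..n} u) (i + l) k * u (Suc j) ^ k)) l)"
      by (subst sum.swap) (simp add: sum_distrib_left monom_sum)
    also have "\<dots> = (\<Sum>l\<le>n. z j ^ i * monom (u (Suc j) ^ l * elem_sym {1..n} v l) l)"
      unfolding pr by (intro sum.cong refl) (simp add: zpow mult_monom power_add mult.commute mult.left_commute)
    also have "\<dots> = z j ^ i * D j"
      by (simp only: D_def prod_eq_sum_elem_sym sum_distrib_left)
    finally show ?thesis .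
  qed
  then have "M * transpose_mat W = transpose_mat W * E"
    by (intro eq_matI)
       (auto simp: M_def W_def E_def scalar_prod_def atLeast0LessThan if_distrib[of "\<lambda>x. _ * x"] cong: if_cong)
  then have "det (M * transpose_mat W) = det (transpose_mat W * E)"
    by (rule arg_cong)
  moreover have "det (M * transpose_mat W) = det M * det W"
    using carr det_mult[OF carr(1), of "transpose_mat W"] by (simp add: det_transpose[OF carr(2)])
  moreover have "det (transpose_mat W * E) = det E * det W"
    using carr det_mult[OF _ carr(3), of "transpose_mat W"] by (simp add: det_transpose[OF carr(2)] mult.commute)
  ultimately have "det M * det W = det E * det W"
    by (simp only:)
  moreover have "inj_on z {..<n}"
  proof (rule inj_onI)
    fix i j assume "i \<in> {..<n}" "j \<in> {..<n}" "z i = z j"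
    then show "i = j"
      using inj_onD[OF assms(2), of "Suc i" "Suc j"] by (simp add: z_def)
  qed
  then have "det W \<noteq> 0"
    unfolding W_def by (rule det_vandermonde_nonzero)
  ultimately have "det M = det E"
    using mult_right_cancel by blast
  also have "det E = (\<Prod>j<n. D j)"
    by (subst det_upper_triangular[OF _ carr(3)])
       (auto simp: E_def prod_list_diag_prod atLeast0LessThan)
  also have "\<dots> = (\<Prod>i\<in>{1..n}. \<Prod>w\<in>{1..n}. [:1, u i * v w:])"
    by (rule prod.reindex_bij_witness[of _ "\<lambda>i. i - 1" Suc]) (auto simp: D_def)
  finally show ?thesis
    by (simp add: M_def prod.cartesian_product)
qed

section \<open>Existence and uniqueness of \<open>Q\<^sub>n\<close>\<close>

lemma ex_prime_indexing:
  "\<exists>\<pi> :: nat + nat \<Rightarrow> nat. inj \<pi> \<and> (\<forall>v. prime (\<pi> v))"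
proof -
  have "infinite {p::nat. prime p}" by (rule primes_infinite)
  then obtain f :: "nat \<Rightarrow> nat" where f: "inj f" "range f \<subseteq> {p. prime p}"
    using infinite_countable_subset by blast
  define \<pi> :: "nat + nat \<Rightarrow> nat" where "\<pi> = f \<circ> to_nat"
  have "inj \<pi>"
    unfolding \<pi>_def using f(1) by (intro inj_compose) auto
  moreover have "prime (\<pi> v)" for v
    using f(2) by (auto simp: \<pi>_def)
  ultimately show ?thesis by blast
qed

abbreviation esyms :: "nat \<Rightarrow> (nat \<Rightarrow> 'a::comm_ring_1) \<Rightarrow> (nat \<Rightarrow> 'a) \<Rightarrow> nat + nat \<Rightarrow> 'a"
  where "esyms n u v \<equiv> case_sum (elem_sym {1..n} u) (elem_sym {1..n} v)"

text \<open>Carries identities between polynomials in x and y over to points: evaluation commutes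
  with elementary symmetric functions.\<close>

lemma zeval_esyms:
  "zeval \<tau> (zeval (esyms n (\<lambda>i. indet (Inl i)) (\<lambda>j. indet (Inr j))) Q) =
   zeval (esyms n (\<lambda>i. \<tau> (Inl i)) (\<lambda>j. \<tau> (Inr j))) Q"
  unfolding zeval_zeval
  by (rule arg_cong[of _ _ "\<lambda>\<sigma>. zeval \<sigma> Q"]) (auto simp: zeval_elem_sym zeval_indet split: sum.split)

text \<open>\<open>Q\<close> is the coefficient of X^n in the determinant of
  \<open>norm_entry\<close>, with free variables in place of the elementary symmetric functions. The
  identity is tested at prime powers, where \<open>det_norm_entry\<close> applies.\<close>

lemma ene_poly_exists:
  assumes "n \<ge> 1"
  shows "\<exists>Q. indets Q \<subseteq> Inl ` {1..n} \<union> Inr ` {1..n} \<and>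
    zeval (esyms n (\<lambda>i. indet (Inl i)) (\<lambda>j. indet (Inr j))) Q =
    elem_sym ({1..n} \<times> {1..n}) (\<lambda>(i, j). indet (Inl i) * indet (Inr j)) n"
proof -
  let ?V = "Inl ` {1..n} \<union> Inr ` {1..n} :: (nat + nat) set"
  let ?M = "\<lambda>\<sigma> i k. norm_entry n (\<lambda>i. \<sigma> (Inl i)) (\<lambda>j. \<sigma> (Inr j)) i k :: complex poly"
  have "polyfun ?V (\<lambda>\<sigma>. if l = 0 then 1 else \<sigma> (Inr l))" if "l \<le> n" for l
    using that by (cases "l = 0") (auto intro: polyfun_1 polyfun_indet)
  then have "ppolyfun ?V (\<lambda>\<sigma>. ?M \<sigma> i k)" if "k < n" for i k
    unfolding norm_entry_def using that
    by (intro ppolyfun_sum ppolyfun_monom polyfun_mult polyfun_power_rem) auto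
  then have "ppolyfun ?V (\<lambda>\<sigma>. det (mat n n (\<lambda>(i, k). ?M \<sigma> i k)))"
    by (intro ppolyfun_det)
  then obtain Q where Q: "indets Q \<subseteq> ?V"
      "\<And>\<sigma>. zeval \<sigma> Q = coeff (det (mat n n (\<lambda>(i, k). ?M \<sigma> i k))) n"
    unfolding ppolyfun_def polyfun_def by blast
  let ?P = "zeval (esyms n (\<lambda>i. indet (Inl i)) (\<lambda>j. indet (Inr j))) Q"
  let ?P' = "elem_sym ({1..n} \<times> {1..n}) (\<lambda>(i, j). indet (Inl i) * indet (Inr j)) n"
  obtain \<pi> :: "nat + nat \<Rightarrow> nat" where \<pi>: "inj \<pi>" "\<And>v. prime (\<pi> v)"
    using ex_prime_indexing by blast
  have "?P - ?P' = 0"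
  proof (rule zpoly_eq_0_if_vanishing_at_prime_powers[OF \<pi>])
    fix k :: nat assume "k \<ge> 1"
    define \<tau> where "\<tau> v = (of_nat (\<pi> v) ^ k :: complex)" for v
    have "\<tau> v \<noteq> 0" for v
      using \<pi>(2)[of v] by (auto simp: \<tau>_def)
    \<comment> \<open>Gives the distinct coordinates that \<open>det_norm_entry\<close> asks for; it
      rests on \<open>k \<ge> 1\<close>.\<close>
    moreover have "inj \<tau>"
    proof (rule injI)
      fix v w assume "\<tau> v = \<tau> w"
      then have "\<pi> v ^ k = \<pi> w ^ k"
        by (metis \<tau>_def of_nat_eq_iff of_nat_power)
      then show "v = w"
        using \<open>k \<ge> 1\<close> \<pi>(1) by (auto simp: power_eq_iff_eq_base inj_eq)
    qed
    ultimately have "inj_on (\<lambda>i. \<tau> (Inl i)) {1..n}" and "\<tau> (Inl i) \<noteq> 0" for i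
      by (auto simp: inj_on_def inj_def)
    from det_norm_entry[OF assms this, of "\<lambda>j. \<tau> (Inr j)"]
    have "zeval \<tau> ?P = coeff (\<Prod>(i, j)\<in>{1..n} \<times> {1..n}. [:1, \<tau> (Inl i) * \<tau> (Inr j):]) n"
      unfolding zeval_esyms Q(2) by (simp del: One_nat_def)
    also have "\<dots> = coeff (\<Prod>p\<in>{1..n} \<times> {1..n}. [:1, case p of (i, j) \<Rightarrow> \<tau> (Inl i) * \<tau> (Inr j):]) n"
      by (simp add: case_prod_unfold)
    also have "\<dots> = zeval \<tau> ?P'"
      by (simp add: coeff_prod_linear zeval_elem_sym case_prod_unfold zeval_mult zeval_indet)
    finally show "zeval \<tau> (?P - ?P') = 0"
      unfolding zeval_diff by simp
  qed
  with Q(1) show ?thesis by auto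
qed

text \<open>By \<open>elem_sym_surj\<close> the points \<open>esyms n u v\<close> realize all
  complex values of the variables of \<open>Q\<close> and \<open>Q'\<close>, so the two agree at
  every complex point.\<close>

lemma zpoly_eq_if_agree_on_esyms:
  assumes "indets Q \<subseteq> Inl ` {1..n} \<union> Inr ` {1..n}" "indets Q' \<subseteq> Inl ` {1..n} \<union> Inr ` {1..n}"
    and agree: "zeval (esyms n (\<lambda>i. indet (Inl i)) (\<lambda>j. indet (Inr j))) Q =
      zeval (esyms n (\<lambda>i. indet (Inl i)) (\<lambda>j. indet (Inr j))) Q'"
  shows "Q = Q'"
proof -
  obtain \<pi> :: "nat + nat \<Rightarrow> nat" where \<pi>: "inj \<pi>" "\<And>v. prime (\<pi> v)"
    using ex_prime_indexing by blast
  have "zeval \<tau> Q = zeval \<tau> Q'" for \<tau> :: "nat + nat \<Rightarrow> complex"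
  proof -
    obtain u where u: "\<And>k. k \<in> {1..n} \<Longrightarrow> elem_sym {1..n} u k = \<tau> (Inl k)"
      using elem_sym_surj[of n "\<lambda>k. \<tau> (Inl k)"] by blast
    obtain v where v: "\<And>k. k \<in> {1..n} \<Longrightarrow> elem_sym {1..n} v k = \<tau> (Inr k)"
      using elem_sym_surj[of n "\<lambda>k. \<tau> (Inr k)"] by blast
    have "zeval \<tau> R = zeval (esyms n u v) R" if "indets R \<subseteq> Inl ` {1..n} \<union> Inr ` {1..n}" for R
      using that u v by (intro zeval_cong) auto
    then show ?thesis
      using assms zeval_esyms[of "case_sum u v" n Q] zeval_esyms[of "case_sum u v" n Q'] by simp
  qed
  then have "Q - Q' = 0"
    by (intro zpoly_eq_0_if_vanishing_at_prime_powers[OF \<pi>]) (simp add: zeval_diff)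
  then show ?thesis by simp
qed

lemma ene_poly:
  assumes "n \<ge> 1"
  shows indets_ene_poly: "indets (ene_poly n) \<subseteq> Inl ` {1..n} \<union> Inr ` {1..n}"
    and zeval_ene_poly: "zeval (esyms n (\<lambda>i. indet (Inl i)) (\<lambda>j. indet (Inr j))) (ene_poly n) =
      elem_sym ({1..n} \<times> {1..n}) (\<lambda>(i, j). indet (Inl i) * indet (Inr j)) n"
proof -
  have "\<exists>!Q. indets Q \<subseteq> Inl ` {1..n} \<union> Inr ` {1..n} \<and>
    zeval (esyms n (\<lambda>i. indet (Inl i)) (\<lambda>j. indet (Inr j))) Q =
    elem_sym ({1..n} \<times> {1..n}) (\<lambda>(i, j). indet (Inl i) * indet (Inr j)) n"
    using ene_poly_exists[OF assms] by (rule ex_ex1I)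
      (elim conjE, rule zpoly_eq_if_agree_on_esyms, assumption+, simp only:)
  from theI'[OF this] show "indets (ene_poly n) \<subseteq> Inl ` {1..n} \<union> Inr ` {1..n}"
    "zeval (esyms n (\<lambda>i. indet (Inl i)) (\<lambda>j. indet (Inr j))) (ene_poly n) =
      elem_sym ({1..n} \<times> {1..n}) (\<lambda>(i, j). indet (Inl i) * indet (Inr j)) n"
    by (simp_all add: ene_poly_def eval_zpoly_type_algebra)
qed

lemma zeval_ene_poly_complex:
  fixes u v :: "nat \<Rightarrow> complex"
  assumes "n \<ge> 1"
  shows "zeval (esyms n u v) (ene_poly n) = elem_sym ({1..n} \<times> {1..n}) (\<lambda>(i, j). u i * v j) n"
proof -
  have "zeval (esyms n u v) (ene_poly n) =
    zeval (case_sum u v) (elem_sym ({1..n} \<times> {1..n}) (\<lambda>(i, j). indet (Inl i) * indet (Inr j)) n)"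
    using zeval_esyms[of "case_sum u v" n "ene_poly n"] by (simp add: zeval_ene_poly[OF assms] del: One_nat_def)
  then show ?thesis
    by (simp add: zeval_elem_sym case_prod_unfold zeval_mult zeval_indet del: One_nat_def)
qed

section \<open>The product of polynomials\<close>

text \<open>\<open>r\<close> and \<open>s\<close> are unrelated to \<open>n\<close>, so the inverse
  roots are first traded for \<open>n\<close> numbers of each kind with the same coefficients up to
  \<open>n\<close>.\<close>

lemma ene_prod_prod_linear_nth:
  fixes u v :: "nat \<Rightarrow> complex" and r s :: nat
  defines "p \<equiv> \<Prod>i\<in>{1..r}. [:1, - u i:]" and "q \<equiv> \<Prod>j\<in>{1..s}. [:1, - v j:]"
  assumes "n \<ge> 1"
  shows "(- 1) ^ n * zeval (case_sum (coeff p) (coeff q)) (ene_poly n) =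
    coeff (\<Prod>(i, j)\<in>{1..r} \<times> {1..s}. [:1, - (u i * v j):]) n"
proof -
  \<comment> \<open>The new inverse roots are the negatives of \<open>u'\<close> and
    \<open>v'\<close>, as \<open>elem_sym\<close> belongs to factors 1 + u'_i X; the signs cancel in
    the products.\<close>
  obtain u' where u': "\<And>k. k \<in> {1..n} \<Longrightarrow> elem_sym {1..n} u' k = coeff p k"
    using elem_sym_surj[of n "coeff p"] by blast
  obtain v' where v': "\<And>k. k \<in> {1..n} \<Longrightarrow> elem_sym {1..n} v' k = coeff q k"
    using elem_sym_surj[of n "coeff q"] by blast
  have coeff_0: "coeff p 0 = 1" "coeff q 0 = 1"
    by (simp_all add: p_def q_def coeff_prod_linear del: One_nat_def)
  have "coeff p k = coeff (\<Prod>i\<in>{1..n}. [:1, - (- u' i):]) k" if "k \<le> n" for k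
    using u'[of k] coeff_0 that by (cases "k = 0") (simp_all add: coeff_prod_linear del: One_nat_def)
  moreover have "coeff q k = coeff (\<Prod>i\<in>{1..n}. [:1, - (- v' i):]) k" if "k \<le> n" for k
    using v'[of k] coeff_0 that by (cases "k = 0") (simp_all add: coeff_prod_linear del: One_nat_def)
  ultimately have "coeff (\<Prod>(i, j)\<in>{1..r} \<times> {1..s}. [:1, - (u i * v j):]) n =
      coeff (\<Prod>(i, j)\<in>{1..n} \<times> {1..n}. [:1, - ((- u' i) * (- v' j)):]) n"
    unfolding p_def q_def by (intro coeff_prod_products_cong) auto
  also have "\<dots> = coeff (\<Prod>p\<in>{1..n} \<times> {1..n}. [:1, - 1 * (case p of (i, j) \<Rightarrow> u' i * v' j):]) n"
    by (simp add: case_prod_unfold)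
  \<comment> \<open>Pulling -1 out of e_n produces the sign in the definition of \<star>.\<close>
  also have "\<dots> = (- 1) ^ n * elem_sym ({1..n} \<times> {1..n}) (\<lambda>(i, j). u' i * v' j) n"
    by (subst coeff_prod_linear) (simp_all only: elem_sym_mult_left finite_cartesian_product finite_atLeastAtMost)
  also have "elem_sym ({1..n} \<times> {1..n}) (\<lambda>(i, j). u' i * v' j) n = zeval (esyms n u' v') (ene_poly n)"
    by (rule zeval_ene_poly_complex[OF assms(3), symmetric])
  \<comment> \<open>Only variables with index from 1 to \<open>n\<close> occur in
    \<open>ene_poly n\<close>, and there the values agree.\<close>
  also have "\<dots> = zeval (case_sum (coeff p) (coeff q)) (ene_poly n)"
    using indets_ene_poly[OF assms(3)] u' v' by (intro zeval_cong) auto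
  finally show ?thesis by (rule sym)
qed

lemma proots_normalized_linear:
  assumes "a \<noteq> 0"
  shows "proots [:1, - inverse a:] = {#a :: 'a::field#}"
proof -
  have "proots [:1, - inverse a:] = proots (smult (- inverse a) [:- a, 1:])"
    using assms by simp
  also have "\<dots> = proots [:- a, 1:]"
    using assms by (intro proots_smult) simp
  also have "\<dots> = {#a#}"
    by (simp only: proots_linear_factor minus_minus)
  finally show ?thesis .
qed

text \<open>The constant term 1 excludes the root 0, so each X - \<alpha> i rescales to 1 -
  X/\<alpha> i; comparing constant terms shows that the overall factor \<open>c\<close> is
  1.\<close>

lemma complex_poly_eq_prod_normalized_linear:
  fixes p :: "complex poly"
  assumes "coeff p 0 = 1" "proots p = image_mset \<alpha> (mset_set I)" "finite I"
  shows "p = (\<Prod>i\<in>I. [:1, - inverse (\<alpha> i):])" and "i \<in> I \<Longrightarrow> \<alpha> i \<noteq> 0"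
proof -
  have "p \<noteq> 0" using assms(1) by auto
  have "poly p (\<alpha> i) = 0" if "i \<in> I" for i
    using set_count_proots[OF \<open>p \<noteq> 0\<close>] assms(2,3) that by auto
  then show nz: "\<alpha> i \<noteq> 0" if "i \<in> I" for i
    using that assms(1) by (metis poly_0_coeff_0 zero_neq_one)
  define c where "c = lead_coeff p * (\<Prod>i\<in>I. - \<alpha> i)"
  have "p = smult (lead_coeff p) (\<Prod>i\<in>I. [:- \<alpha> i, 1:])"
    using complex_poly_decompose_multiset[of p] assms(2) by (simp add: image_mset.compositionality o_def prod_unfold_prod_mset)
  also have "(\<Prod>i\<in>I. [:- \<alpha> i, 1:]) = (\<Prod>i\<in>I. smult (- \<alpha> i) [:1, - inverse (\<alpha> i):])"
    using nz by (intro prod.cong) auto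
  finally have p: "p = smult c (\<Prod>i\<in>I. [:1, - inverse (\<alpha> i):])"
    unfolding prod_smult smult_smult c_def .
  have "coeff p 0 = c"
    by (subst p) (simp add: coeff_prod_linear assms(3))
  with p assms(1) show "p = (\<Prod>i\<in>I. [:1, - inverse (\<alpha> i):])"
    by simp
qed

text \<open>The inverse roots of \<open>h\<close> are the products of the inverse roots of
  \<open>p\<close> and \<open>q\<close>. It is compared with the \<star> product coefficient by
  coefficient, and each of its linear factors contributes one root.\<close>

lemma ene_prod_polynomials:
  fixes p q :: "complex poly" and \<alpha> \<beta> :: "nat \<Rightarrow> complex" and r s :: nat
  assumes S: "subring S ring_of_type_algebra" and A: "A = ring_of_type_algebra\<lparr>carrier := S\<rparr>"
    and p: "fps_of_poly p \<in> one_series A" "proots p = image_mset \<alpha> (mset_set {1..r})"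
    and q: "fps_of_poly q \<in> one_series A" "proots q = image_mset \<beta> (mset_set {1..s})"
  defines "h \<equiv> \<Prod>(i, j)\<in>{1..r} \<times> {1..s}. [:1, - (inverse (\<alpha> i) * inverse (\<beta> j)):]"
  shows "fps_of_poly p \<star>\<^bsub>A\<^esub> fps_of_poly q = fps_of_poly h"
    and "proots h = image_mset (\<lambda>(i, j). \<alpha> i * \<beta> j) (mset_set ({1..r} \<times> {1..s}))"
proof -
  have A_simps: "carrier A = S" "\<one>\<^bsub>A\<^esub> = 1" "\<zero>\<^bsub>A\<^esub> = 0" "\<And>x y. x \<oplus>\<^bsub>A\<^esub> y = x + y" "\<And>x y. x \<otimes>\<^bsub>A\<^esub> y = x * y"
    by (simp_all add: A ring_of_type_algebra_def)
  have coeffs: "coeff p 0 = 1" "coeff q 0 = 1" "\<And>k. coeff p k \<in> S" "\<And>k. coeff q k \<in> S"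
    using p(1) q(1) by (simp_all add: one_series_def A_simps)
  note p_eq = complex_poly_eq_prod_normalized_linear[OF coeffs(1) p(2) finite_atLeastAtMost]
  note q_eq = complex_poly_eq_prod_normalized_linear[OF coeffs(2) q(2) finite_atLeastAtMost]
  interpret R: cring "ring_of_type_algebra :: complex ring" by rule
  interpret A: cring A
    unfolding A using R.subcring_iff[of S] R.subcringI'[OF S] by (simp add: ring_of_type_algebra_def)
  have "\<ominus>\<^bsub>A\<^esub> \<one>\<^bsub>A\<^esub> = - 1"
    using A.r_neg[OF A.one_closed] by (simp add: A_simps eq_neg_iff_add_eq_0 add.commute)
  then have sign: "(\<ominus>\<^bsub>A\<^esub> \<one>\<^bsub>A\<^esub>) [^]\<^bsub>A\<^esub> n = (- 1) ^ n" for n :: nat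
    by (induction n) (simp_all add: A_simps)
  have "fps_nth (fps_of_poly p \<star>\<^bsub>A\<^esub> fps_of_poly q) n = coeff h n" for n
  proof (cases "n = 0")
    case True
    have "h = (\<Prod>x\<in>{1..r} \<times> {1..s}. [:1, case x of (i, j) \<Rightarrow> - (inverse (\<alpha> i) * inverse (\<beta> j)):])"
      by (simp add: h_def case_prod_unfold)
    then have "coeff h 0 = 1"
      by (simp add: coeff_prod_linear del: One_nat_def)
    then show ?thesis
      using True by (simp add: ene_prod_def A_simps)
  next
    case False
    have "eval_zpoly A (case_sum (coeff p) (coeff q)) (ene_poly n) =
        zeval (case_sum (coeff p) (coeff q)) (ene_poly n)"
      using coeffs by (intro eval_zpoly_subring[OF S A]) (auto split: sum.split)
    \<comment> \<open>An equality of functions, so that it rewrites inside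
      \<open>case_sum\<close>.\<close>
    moreover have "fps_nth (fps_of_poly f) = coeff f" for f :: "complex poly"
      by (rule ext) simp
    ultimately have "fps_nth (fps_of_poly p \<star>\<^bsub>A\<^esub> fps_of_poly q) n =
        (- 1) ^ n * zeval (case_sum (coeff p) (coeff q)) (ene_poly n)"
      using False by (simp add: ene_prod_def A_simps sign[unfolded A_simps])
    also have "\<dots> = coeff h n"
      using ene_prod_prod_linear_nth[of n "\<lambda>i. inverse (\<alpha> i)" r "\<lambda>j. inverse (\<beta> j)" s] False
      unfolding h_def p_eq(1)[symmetric] q_eq(1)[symmetric] by simp
    finally show ?thesis .
  qed
  then show "fps_of_poly p \<star>\<^bsub>A\<^esub> fps_of_poly q = fps_of_poly h"
    by (intro fps_ext) simp
  have "h = (\<Prod>x\<in>{1..r} \<times> {1..s}. [:1, - inverse (case x of (i, j) \<Rightarrow> \<alpha> i * \<beta> j):])"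
    by (simp add: h_def case_prod_unfold)
  then have "proots h = (\<Sum>x\<in>{1..r} \<times> {1..s}. proots [:1, - inverse (case x of (i, j) \<Rightarrow> \<alpha> i * \<beta> j):])"
    by (simp add: proots_prod)
  also have "\<dots> = (\<Sum>x\<in>{1..r} \<times> {1..s}. {#case x of (i, j) \<Rightarrow> \<alpha> i * \<beta> j#})"
    using p_eq(2) q_eq(2) by (intro sum.cong refl proots_normalized_linear) auto
  also have "\<dots> = image_mset (\<lambda>(i, j). \<alpha> i * \<beta> j) (mset_set ({1..r} \<times> {1..s}))"
    by (simp add: sum_unfold_sum_mset)
  finally show "proots h = image_mset (\<lambda>(i, j). \<alpha> i * \<beta> j) (mset_set ({1..r} \<times> {1..s}))" .
qed

theorem proposition2p3:
  shows "(\<forall>A :: ('a, 'm) ring_scheme. cring A \<longrightarrow>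
      (\<forall>f \<in> one_series A. \<forall>g \<in> one_series A. f \<star>\<^bsub>A\<^esub> g \<in> one_series A)) \<and>
    (\<forall>(S :: complex set) (A :: complex ring) (p :: complex poly) (q :: complex poly)
        (r :: nat) (s :: nat) (\<alpha> :: nat \<Rightarrow> complex) (\<beta> :: nat \<Rightarrow> complex).
      subring S ring_of_type_algebra \<longrightarrow>
      A = ring_of_type_algebra\<lparr>carrier := S\<rparr> \<longrightarrow>
      fps_of_poly p \<in> one_series A \<longrightarrow>
      fps_of_poly q \<in> one_series A \<longrightarrow>
      proots p = image_mset \<alpha> (mset_set {1..r}) \<longrightarrow>
      proots q = image_mset \<beta> (mset_set {1..s}) \<longrightarrow>
      (\<exists>h :: complex poly.
        fps_of_poly p \<star>\<^bsub>A\<^esub> fps_of_poly q = fps_of_poly h \<and>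
        proots h = image_mset (\<lambda>(i, j). \<alpha> i * \<beta> j) (mset_set ({1..r} \<times> {1..s}))))"
proof (intro conjI allI ballI impI)
  fix A :: "('a, 'm) ring_scheme" and f g
  assume "cring A" "f \<in> one_series A" "g \<in> one_series A"
  then show "f \<star>\<^bsub>A\<^esub> g \<in> one_series A"
    by (rule ene_prod_closed)
next
  fix S :: "complex set" and A :: "complex ring" and p q :: "complex poly"
    and r s :: nat and \<alpha> \<beta> :: "nat \<Rightarrow> complex"
  assume asms: "subring S ring_of_type_algebra" "A = ring_of_type_algebra\<lparr>carrier := S\<rparr>"
    "fps_of_poly p \<in> one_series A" "fps_of_poly q \<in> one_series A"
    "proots p = image_mset \<alpha> (mset_set {1..r})" "proots q = image_mset \<beta> (mset_set {1..s})"
  show "\<exists>h. fps_of_poly p \<star>\<^bsub>A\<^esub> fps_of_poly q = fps_of_poly h \<and>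
      proots h = image_mset (\<lambda>(i, j). \<alpha> i * \<beta> j) (mset_set ({1..r} \<times> {1..s}))"
    using ene_prod_polynomials[OF asms(1-3,5,4,6)] by (intro exI conjI)
qed

end
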